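(* Let $b \geq 2$ be an integer. Let $s_b(n)$ be the sum of digits of $n$ in base $b$. Then $$\lim_{k \to \infty} \sum_{\substack{n \geq 1 \\ s_b(n) = k}} \frac{1}{n} = \frac{2 \log b}{b-1}.$$
   Context: For an integer $n \ge 0$, $s_b(n)$ is the sum of the digits (in $\{0,1,\dots,b-1\}$) of the base-$b$ expansion of $n$. The inner sum runs over all integers $n \ge 1$ with $s_b(n) = k$. $\log$ is the natural logarithm. *)

theory Defs
  imports "HOL-Analysis.Analysis"
begin

text \<open>
  The digit of \<open>n\<close> at position \<open>i\<close> in base \<open>b\<close> is \<open>n div b ^ i mod b\<close>, and the positions occupied
  by the expansion of \<open>n\<close> are those with \<open>b ^ i \<le> n\<close>. This is meaningful only for \<open>b \<ge> 2\<close>.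
\<close>

definition digit_sum :: "nat \<Rightarrow> nat \<Rightarrow> nat" where
  "digit_sum b n = (\<Sum>i | b ^ i \<le> n. n div b ^ i mod b)"

lemma finite_digit_positions:
  fixes b n :: nat
  assumes "b \<ge> 2"
  shows "finite {i. b ^ i \<le> n}"
proof (rule finite_subset)
  show "{i. b ^ i \<le> n} \<subseteq> {..n}"
  proof
    fix i assume "i \<in> {i. b ^ i \<le> n}"
    moreover have "i < b ^ i"
      using assms by (intro less_le_trans[OF less_exp power_mono]) auto
    ultimately show "i \<in> {..n}" by simp
  qed
qed simp

lemma digit_sum_rec:
  assumes "b \<ge> 2"
  shows "digit_sum b n = n mod b + digit_sum b (n div b)"
proof (cases "n = 0")
  case True
  then show ?thesis using assms by (simp add: digit_sum_def)
next
  case False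
  have pos: "{i. b ^ i \<le> n} = insert 0 (Suc ` {i. b ^ i \<le> n div b})" (is "?L = ?R")
  proof (rule set_eqI)
    fix i
    show "i \<in> ?L \<longleftrightarrow> i \<in> ?R"
      using assms False by (cases i) (auto simp: less_eq_div_iff_mult_less_eq mult.commute)
  qed
  show ?thesis
    unfolding digit_sum_def pos using finite_digit_positions[OF assms]
    by (simp add: sum.reindex div_mult2_eq)
qed

lemma digit_sum_horner_sum:
  assumes "b \<ge> 2" and "\<forall>d\<in>set ds. d < b"
  shows "digit_sum b (horner_sum id b ds) = sum_list ds"
  using assms(2)
proof (induction ds)
  case Nil
  show ?case using assms(1) by (simp add: digit_sum_def)
next
  case (Cons d ds)
  then show ?case using assms(1) by (subst digit_sum_rec) (auto simp: id_def)
qed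

end

theory Submission
  imports Defs
begin

text \<open>
  The claim is a renewal theorem in disguise. Fix \<open>J\<close> and write an integer with at least \<open>J + 1\<close>
  digits as \<open>n = m * b ^ L + r\<close>, where \<open>m\<close> consists of the leading \<open>J + 1\<close> digits and \<open>r < b ^ L\<close>. Digit
  sums add, and \<open>1 / n\<close> lies between \<open>1 / ((m + 1) * b ^ L)\<close> and \<open>1 / (m * b ^ L)\<close>. For fixed \<open>m\<close>, the
  sum of \<open>1 / b ^ L\<close> over all \<open>L\<close> and \<open>r\<close> with the prescribed digit sum \<open>j = k - digit_sum b m\<close> is
  \<open>u j\<close>, the sum over \<open>L\<close> of the probability that \<open>L\<close> independent uniform digits add up to \<open>j\<close>. Hence,
  once \<open>k\<close> exceeds the digit sums of all \<open>n < b ^ J\<close>, the sum in question lies between the sums of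
  \<open>u (k - digit_sum b m) / (m + 1)\<close> and of \<open>u (k - digit_sum b m) / m\<close> over \<open>b ^ J \<le> m < b ^ (J + 1)\<close>.

  A random digit has mean \<open>(b - 1) / 2\<close>, so \<open>u\<close> should tend to \<open>2 / (b - 1)\<close> (\<open>renewal_tendsto\<close>).
  Conditioning on one digit shows that, for positive arguments, \<open>u\<close> is the average of its previous
  \<open>b - 1\<close> values (\<open>renewal_equation\<close>), and such sequences converge (\<open>moving_average_tendsto\<close>): a
  weighted sum of squares is decreasing, which forces the oscillation to vanish, while a weighted sum of
  values is constant, which determines the limit.

  Letting \<open>k\<close> tend to infinity bounds the limit points by \<open>2 / (b - 1)\<close> times the sums of
  \<open>1 / (m + 1)\<close> and \<open>1 / m\<close>. Both differ from \<open>ln b\<close> by at most \<open>1 / b ^ J\<close> (\<open>ln_block_bounds\<close>), and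
  \<open>J\<close> is arbitrary.
\<close>

section \<open>Sequences of moving averages\<close>

text \<open>
  With \<open>I n\<close> and \<open>V n\<close> the sums of \<open>(i + 1) * w (n + i)\<close> and of \<open>(i + 1) * (w (n + i))\<^sup>2\<close> over the
  window, passing from \<open>n\<close> to \<open>n + 1\<close> leaves \<open>I\<close> unchanged and lowers \<open>V\<close> by the sum of squared
  deviations of the window from its mean \<open>w (n + q)\<close>. As \<open>V \<ge> 0\<close>, these deviations tend to 0, so that
  \<open>I n\<close> differs from \<open>w (n + q)\<close> times the total weight by a null sequence.
\<close>

lemma moving_average_tendsto:
  fixes w :: "nat \<Rightarrow> real"
  assumes q: "q \<ge> 1" and avg: "\<And>n. real q * w (n + q) = (\<Sum>i<q. w (n + i))"
  shows "w \<longlonglongrightarrow> 2 * (\<Sum>i<q. real (i + 1) * w i) / (real q * real (q + 1))"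
proof -
  \<comment> \<open>Used twice: with \<open>f = w\<close> for the invariant and with \<open>f = w\<^sup>2\<close> for the decreasing quantity.\<close>
  have telescope: "(\<Sum>i<q. real (i + 1) * f (Suc n + i)) - (\<Sum>i<q. real (i + 1) * f (n + i))
      = real q * f (n + q) - (\<Sum>i<q. f (n + i))" for f :: "nat \<Rightarrow> real" and n
    by (induction q) (auto simp: algebra_simps)
  define I where "I n = (\<Sum>i<q. real (i + 1) * w (n + i))" for n
  define V where "V n = (\<Sum>i<q. real (i + 1) * (w (n + i))\<^sup>2)" for n
  have "I (Suc n) = I n" for n
    using telescope[of w n] avg[of n] by (simp add: I_def)
  then have I_const: "I n = I 0" for n
    by (induction n) auto
  have V_drop: "V n - V (Suc n) = (\<Sum>i<q. (w (n + i) - w (n + q))\<^sup>2)" for n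
  proof -
    have "(\<Sum>i<q. (w (n + i) - w (n + q))\<^sup>2)
        = (\<Sum>i<q. (w (n + i))\<^sup>2) - 2 * w (n + q) * (\<Sum>i<q. w (n + i)) + real q * (w (n + q))\<^sup>2"
      by (simp add: power2_diff sum.distrib sum_subtractf sum_distrib_left algebra_simps)
    also have "\<dots> = (\<Sum>i<q. (w (n + i))\<^sup>2) - real q * (w (n + q))\<^sup>2"
      unfolding avg[symmetric] by (simp add: power2_eq_square)
    finally show ?thesis
      using telescope[of "\<lambda>i. (w i)\<^sup>2" n] by (simp add: V_def)
  qed
  have "decseq V"
    unfolding decseq_Suc_iff
  proof
    fix n
    have "0 \<le> V n - V (Suc n)" unfolding V_drop by (intro sum_nonneg) auto
    then show "V (Suc n) \<le> V n" by simp
  qed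
  moreover have "0 \<le> V n" for n
    unfolding V_def by (intro sum_nonneg) auto
  ultimately obtain v where "V \<longlonglongrightarrow> v"
    using decseq_convergent[of V 0] by blast
  then have "(\<lambda>n. V n - V (Suc n)) \<longlonglongrightarrow> v - v"
    by (intro tendsto_diff LIMSEQ_Suc)
  then have drop0: "(\<lambda>n. V n - V (Suc n)) \<longlonglongrightarrow> 0" by simp
  have diff0: "(\<lambda>n. w (n + i) - w (n + q)) \<longlonglongrightarrow> 0" if "i < q" for i
  proof -
    have "(\<lambda>n. (w (n + i) - w (n + q))\<^sup>2) \<longlonglongrightarrow> 0"
    proof (rule tendsto_sandwich[OF _ _ tendsto_const drop0])
      show "\<forall>\<^sub>F n in sequentially. (w (n + i) - w (n + q))\<^sup>2 \<le> V n - V (Suc n)"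
        unfolding V_drop using that
        by (intro always_eventually allI member_le_sum) auto
    qed auto
    then show ?thesis by (simp add: power_tendsto_0_iff)
  qed
  define c where "c = real q * real (q + 1) / 2"
  have "(\<Sum>i<q. real (i + 1)) = c"
    unfolding c_def by (induction q) (auto simp: field_simps)
  then have "(\<Sum>i<q. real (i + 1) * (w (n + i) - w (n + q))) = I 0 - c * w (n + q)" for n
    using I_const[of n]
    by (simp only: I_def right_diff_distrib sum_subtractf flip: sum_distrib_right)
  moreover have "(\<lambda>n. \<Sum>i<q. real (i + 1) * (w (n + i) - w (n + q))) \<longlonglongrightarrow> (\<Sum>i<q. real (i + 1) * 0)"
    by (intro tendsto_sum tendsto_mult tendsto_const diff0) auto
  ultimately have "(\<lambda>n. I 0 - c * w (n + q)) \<longlonglongrightarrow> 0" by simp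
  then have "(\<lambda>n. (I 0 - (I 0 - c * w (n + q))) / c) \<longlonglongrightarrow> (I 0 - 0) / c"
    using q by (intro tendsto_intros) (auto simp: c_def)
  then have "(\<lambda>n. w (n + q)) \<longlonglongrightarrow> I 0 / c"
    using q by (simp add: c_def)
  then have "w \<longlonglongrightarrow> I 0 / c" by (rule LIMSEQ_offset)
  then show ?thesis by (simp add: I_def c_def mult.commute)
qed

section \<open>Digit sums and blocks of integers\<close>

lemma digit_sum_0 [simp]: "b \<ge> 2 \<Longrightarrow> digit_sum b 0 = 0"
  by (simp add: digit_sum_def)

lemma digit_sum_less: "b \<ge> 2 \<Longrightarrow> d < b \<Longrightarrow> digit_sum b d = d"
  by (subst digit_sum_rec) auto

lemma digit_sum_concat:
  assumes "b \<ge> 2" "r < b ^ L"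
  shows "digit_sum b (m * b ^ L + r) = digit_sum b m + digit_sum b r"
  using assms(2)
proof (induction L arbitrary: r)
  case 0
  then show ?case using assms(1) by simp
next
  case (Suc L)
  have lt: "r div b < b ^ L"
    using Suc.prems assms(1) by (simp add: less_mult_imp_div_less mult.commute)
  have "m * b ^ Suc L + r = r + b * (m * b ^ L)" by simp
  then have "(m * b ^ Suc L + r) mod b = r mod b" "(m * b ^ Suc L + r) div b = m * b ^ L + r div b"
    using assms(1) by (simp_all only: mod_mult_self2 div_mult_self2)
  then show ?case
    using Suc.IH[OF lt] digit_sum_rec[OF assms(1), of "m * b ^ Suc L + r"]
      digit_sum_rec[OF assms(1), of r] by simp
qed

lemma sum_split_blocks:
  fixes f :: "nat \<Rightarrow> 'a::comm_monoid_add"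
  assumes "a \<le> c"
  shows "(\<Sum>n = a * k..<c * k. f n) = (\<Sum>m = a..<c. \<Sum>r<k. f (m * k + r))"
  using assms
proof (induction c rule: dec_induct)
  case base
  then show ?case by simp
next
  case (step c)
  have "(\<Sum>n = a * k..<Suc c * k. f n)
      = (\<Sum>n = a * k..<c * k. f n) + (\<Sum>n = c * k..<c * k + k. f n)"
    using step.hyps by (subst sum.atLeastLessThan_concat) (auto simp: add.commute)
  moreover have "(\<Sum>n = c * k..<c * k + k. f n) = (\<Sum>r<k. f (c * k + r))"
    using sum.shift_bounds_nat_ivl[of f 0 "c * k" k] by (simp add: lessThan_atLeast0 add.commute)
  ultimately show ?case using step by simp
qed

section \<open>The digit random walk and its renewal function\<close>

text \<open>
  The probability that \<open>L\<close> independent digits, uniform on \<open>{..<b}\<close>, sum to \<open>k\<close>. The target \<open>k\<close> is an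
  integer so that subtracting a digit from it never truncates; negative targets have probability 0.
\<close>

definition digit_prob :: "nat \<Rightarrow> nat \<Rightarrow> int \<Rightarrow> real" where
  "digit_prob b L k = (\<Sum>r<b ^ L. of_bool (int (digit_sum b r) = k)) / real b ^ L"

lemma digit_prob_nonneg: "0 \<le> digit_prob b L k"
  unfolding digit_prob_def by (intro divide_nonneg_nonneg sum_nonneg) auto

lemma digit_prob_neg: "k < 0 \<Longrightarrow> digit_prob b L k = 0"
  by (simp add: digit_prob_def)

lemma digit_prob_0: "b \<ge> 2 \<Longrightarrow> digit_prob b 0 k = of_bool (k = 0)"
  by (auto simp: digit_prob_def)

text \<open>Condition on the leading digit \<open>d\<close>.\<close>

lemma digit_prob_Suc:
  assumes "b \<ge> 2"
  shows "digit_prob b (Suc L) k = (\<Sum>d<b. digit_prob b L (k - int d)) / real b"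
proof -
  have "(\<Sum>r<b ^ Suc L. of_bool (int (digit_sum b r) = k) :: real)
      = (\<Sum>d<b. \<Sum>r<b ^ L. of_bool (int (digit_sum b (d * b ^ L + r)) = k))"
    using sum_split_blocks[of 0 b "\<lambda>r. of_bool (int (digit_sum b r) = k) :: real" "b ^ L"]
    by (simp add: lessThan_atLeast0)
  also have "\<dots> = (\<Sum>d<b. \<Sum>r<b ^ L. of_bool (int (digit_sum b r) = k - int d))"
    using assms by (intro sum.cong refl arg_cong[where f = of_bool])
      (auto simp: digit_sum_concat digit_sum_less)
  finally show ?thesis
    by (simp add: digit_prob_def sum_divide_distrib mult.commute)
qed

text \<open>
  The bound is the exact value at \<open>k = 0\<close> of the full series. Conditioning on one digit bounds a partial
  sum \<open>U k\<close> by itself divided by \<open>b\<close> (digit 0) plus a contribution of strictly smaller targets, so for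
  \<open>k > 0\<close> it is at most an average of \<open>b - 1\<close> earlier values and the bound at 0 propagates.
\<close>

lemma sum_digit_prob_le:
  assumes b: "b \<ge> 2"
  shows "(\<Sum>L<N. digit_prob b L k) \<le> real b / (real b - 1)"
proof -
  define U where "U k = (\<Sum>L<N. digit_prob b L k)" for k
  define C where "C = real b / (real b - 1)"
  have U_neg: "U k = 0" if "k < 0" for k
    using that by (simp add: U_def digit_prob_neg)
  have U_rec: "U k \<le> of_bool (k = 0) + (U k + (\<Sum>d = 1..<b. U (k - int d))) / real b" for k
  proof -
    have "U k \<le> (\<Sum>L<Suc N. digit_prob b L k)"
      by (simp add: U_def digit_prob_nonneg)
    also have "\<dots> = of_bool (k = 0) + (\<Sum>L<N. \<Sum>d<b. digit_prob b L (k - int d)) / real b"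
      using b by (simp only: sum.lessThan_Suc_shift digit_prob_0 digit_prob_Suc sum_divide_distrib)
    also have "(\<Sum>L<N. \<Sum>d<b. digit_prob b L (k - int d)) = (\<Sum>d<b. U (k - int d))"
      unfolding U_def by (rule sum.swap)
    also have "\<dots> = U k + (\<Sum>d = 1..<b. U (k - int d))"
      using b sum.atLeast_Suc_lessThan[of 0 b "\<lambda>d. U (k - int d)"] by (simp add: lessThan_atLeast0)
    finally show ?thesis .
  qed
  have C: "C \<ge> 0" "C * (real b - 1) = real b" using b by (auto simp: C_def)
  have "\<forall>k < int n. U k \<le> C" for n
  proof (induction n)
    case 0
    then show ?case using U_neg C by simp
  next
    case (Suc n)
    have "U (int n) \<le> C"
    proof (cases "n = 0")
      case True
      have "(\<Sum>d = 1..<b. U (0 - int d)) = 0"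
        by (intro sum.neutral) (auto intro: U_neg)
      then have "U 0 * (real b - 1) \<le> real b" using U_rec[of 0] b by (simp add: field_simps)
      then show ?thesis using True b by (simp add: C_def field_simps)
    next
      case False
      have "(\<Sum>d = 1..<b. U (int n - int d)) \<le> (\<Sum>d = 1..<b. C)"
        using Suc by (intro sum_mono) auto
      also have "\<dots> = real b" using C b by (simp add: of_nat_diff mult.commute)
      finally have "U (int n) * (real b - 1) \<le> real b"
        using U_rec[of "int n"] b False by (simp add: field_simps)
      then show ?thesis using b by (simp add: C_def field_simps)
    qed
    moreover have "k < int n \<or> k = int n" if "k < int (Suc n)" for k
      using that by linarith
    ultimately show ?case using Suc by blast
  qed
  from this[of "nat (k + 1)"] have "U k \<le> C"
    using U_neg[of k] C by (cases "k < 0") auto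
  then show ?thesis by (simp add: U_def C_def)
qed

lemma summable_digit_prob: "b \<ge> 2 \<Longrightarrow> summable (\<lambda>L. digit_prob b L k)"
  by (rule summableI_nonneg_bounded[OF digit_prob_nonneg sum_digit_prob_le])

text \<open>
  The expected number of times at which the random walk with uniform digit steps is at \<open>k\<close>. Steps of
  size 0 count, so \<open>renewal b 0 = b / (b - 1)\<close> rather than 1.
\<close>

definition renewal :: "nat \<Rightarrow> int \<Rightarrow> real" where
  "renewal b k = (\<Sum>L. digit_prob b L k)"

lemma renewal_neg: "k < 0 \<Longrightarrow> renewal b k = 0"
  by (simp add: renewal_def digit_prob_neg)

text \<open>
  The factor \<open>b - 1\<close> in place of \<open>b\<close> on the left comes from moving the term of digit 0 across.
\<close>

lemma renewal_equation:
  assumes b: "b \<ge> 2"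
  shows "(real b - 1) * renewal b k = real b * of_bool (k = 0) + (\<Sum>d = 1..<b. renewal b (k - int d))"
proof -
  have "renewal b k = digit_prob b 0 k + (\<Sum>L. digit_prob b (Suc L) k)"
    using suminf_split_head[OF summable_digit_prob[OF b, of k]] by (simp add: renewal_def)
  also have "(\<Sum>L. digit_prob b (Suc L) k) = (\<Sum>d<b. renewal b (k - int d)) / real b"
    using b by (simp add: digit_prob_Suc suminf_divide summable_sum summable_digit_prob
        suminf_sum renewal_def)
  also have "(\<Sum>d<b. renewal b (k - int d)) = renewal b k + (\<Sum>d = 1..<b. renewal b (k - int d))"
    using b sum.atLeast_Suc_lessThan[of 0 b "\<lambda>d. renewal b (k - int d)"]
    by (simp add: lessThan_atLeast0)
  finally show ?thesis using b by (simp add: digit_prob_0 field_simps)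
qed

text \<open>
  The renewal equation for \<open>k > 0\<close> says that the function is a moving average with window \<open>b - 1\<close>.
  Starting the window at \<open>-(b - 2), \<dots>, 0\<close>, all its entries but the last vanish, and the invariant of
  \<open>moving_average_tendsto\<close> evaluates to \<open>(b - 1) * renewal b 0 = b\<close>.
\<close>

lemma renewal_tendsto:
  assumes b: "b \<ge> 2"
  shows "(\<lambda>k. renewal b (int k - int s)) \<longlonglongrightarrow> 2 / (real b - 1)"
proof -
  define q where "q = b - 1"
  have q: "q \<ge> 1" "b = Suc q" using b by (auto simp: q_def)
  define w where "w n = renewal b (int n - int (q - 1))" for n
  have w_small: "w i = 0" if "i < q - 1" for i
    using that by (auto simp: w_def intro: renewal_neg)
  have "real q * w (n + q) = (\<Sum>i<q. w (n + i))" for n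
  proof -
    have "real q * w (n + q) = (\<Sum>d = 1..<Suc q. w (n + q - d))"
      using renewal_equation[OF b, of "int (n + q) - int (q - 1)"] q
      by (simp add: w_def of_nat_diff algebra_simps)
    also have "\<dots> = (\<Sum>i<q. w (n + i))"
      by (rule sum.reindex_bij_witness[of _ "\<lambda>i. q - i" "\<lambda>d. q - d"]) auto
    finally show ?thesis .
  qed
  then have "w \<longlonglongrightarrow> 2 * (\<Sum>i<q. real (i + 1) * w i) / (real q * real (q + 1))"
    by (intro moving_average_tendsto q)
  also have "(\<Sum>i<q. real (i + 1) * w i) = real b"
  proof -
    have "(\<Sum>i<q. real (i + 1) * w i) = (\<Sum>i\<in>{q - 1}. real (i + 1) * w i)"
    proof (intro sum.mono_neutral_right ballI)
      fix i assume "i \<in> {..<q} - {q - 1}"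
      then have "i < q - 1" by auto
      then show "real (i + 1) * w i = 0" by (simp add: w_small)
    qed (use q in auto)
    also have "\<dots> = (real b - 1) * renewal b 0" using q by (simp add: w_def)
    also have "\<dots> = real b"
      using renewal_equation[OF b, of 0] by (simp add: renewal_neg)
    finally show ?thesis .
  qed
  also have "2 * real b / (real q * real (q + 1)) = 2 / (real b - 1)"
  proof -
    have "real (q + 1) = real b" "real b - 1 = real q" "real b \<noteq> 0" using q by auto
    then show ?thesis by (simp only: mult_divide_mult_cancel_right not_False_eq_True)
  qed
  finally have "(\<lambda>n. w (n + (q - 1))) \<longlonglongrightarrow> 2 / (real b - 1)"
    by (rule LIMSEQ_ignore_initial_segment)
  then have "(\<lambda>k. renewal b (int (k + s) - int s)) \<longlonglongrightarrow> 2 / (real b - 1)"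
    by (simp add: w_def)
  then show ?thesis by (rule LIMSEQ_offset)
qed

section \<open>Sums over integers of given length and digit sum\<close>

definition block_sum :: "nat \<Rightarrow> nat \<Rightarrow> nat \<Rightarrow> real" where
  "block_sum b k N = (\<Sum>n = b ^ N..<b ^ Suc N. of_bool (digit_sum b n = k) / real n)"

lemma block_sum_nonneg: "0 \<le> block_sum b k N"
  unfolding block_sum_def by (intro sum_nonneg) auto

text \<open>
  The integers with \<open>L + J + 1\<close> digits are sorted by their leading \<open>J + 1\<close> digits \<open>m\<close>. The digit-sum
  condition is put in the form in which it defines \<open>digit_prob\<close>.
\<close>

lemma block_sum_split:
  assumes "b \<ge> 2"
  shows "block_sum b k (L + J) = (\<Sum>m = b ^ J..<b ^ Suc J. \<Sum>r<b ^ L.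
      of_bool (int (digit_sum b r) = int k - int (digit_sum b m)) / real (m * b ^ L + r))"
proof -
  have "block_sum b k (L + J) = (\<Sum>m = b ^ J..<b ^ Suc J. \<Sum>r<b ^ L.
      of_bool (digit_sum b (m * b ^ L + r) = k) / real (m * b ^ L + r))"
    using sum_split_blocks[of "b ^ J" "b ^ Suc J"
        "\<lambda>n. of_bool (digit_sum b n = k) / real n" "b ^ L"] assms
    by (simp add: block_sum_def power_add mult_ac)
  also have "\<dots> = (\<Sum>m = b ^ J..<b ^ Suc J. \<Sum>r<b ^ L.
      of_bool (int (digit_sum b r) = int k - int (digit_sum b m)) / real (m * b ^ L + r))"
    using assms by (intro sum.cong refl arg_cong2[where f = "(/)"] arg_cong[where f = of_bool])
      (auto simp: digit_sum_concat)
  finally show ?thesis .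
qed

lemma block_sum_le:
  assumes "b \<ge> 2"
  shows "block_sum b k (L + J)
    \<le> (\<Sum>m = b ^ J..<b ^ Suc J. digit_prob b L (int k - int (digit_sum b m)) / real m)"
  unfolding block_sum_split[OF assms] digit_prob_def sum_divide_distrib
proof (intro sum_mono)
  fix m r assume "m \<in> {b ^ J..<b ^ Suc J}"
  then have "m > 0" using assms by (auto intro: less_le_trans[of 0 "b ^ J"])
  then have "real m * real b ^ L \<le> real (m * b ^ L + r)" "0 < real m * real b ^ L" using assms by simp_all
  then show "of_bool (int (digit_sum b r) = int k - int (digit_sum b m)) / real (m * b ^ L + r)
      \<le> of_bool (int (digit_sum b r) = int k - int (digit_sum b m)) / real b ^ L / real m"
    by (simp add: frac_le mult.commute)
qed

lemma block_sum_ge: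
  assumes "b \<ge> 2"
  shows "(\<Sum>m = b ^ J..<b ^ Suc J. digit_prob b L (int k - int (digit_sum b m)) / real (m + 1))
    \<le> block_sum b k (L + J)"
  unfolding block_sum_split[OF assms] digit_prob_def sum_divide_distrib
proof (intro sum_mono)
  fix m r assume "m \<in> {b ^ J..<b ^ Suc J}" and r: "r \<in> {..<b ^ L}"
  then have "m > 0" using assms by (auto intro: less_le_trans[of 0 "b ^ J"])
  moreover have "m * b ^ L + r \<le> (m + 1) * b ^ L" using r by simp
  then have "real (m * b ^ L + r) \<le> real (m + 1) * real b ^ L"
    by (metis of_nat_le_iff of_nat_mult of_nat_power)
  moreover have "0 < m * b ^ L + r" using \<open>m > 0\<close> assms by simp
  then have "0 < real (m * b ^ L + r)" by (rule of_nat_0_less_iff[THEN iffD2])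
  ultimately show "of_bool (int (digit_sum b r) = int k - int (digit_sum b m)) / real b ^ L / real (m + 1)
      \<le> of_bool (int (digit_sum b r) = int k - int (digit_sum b m)) / real (m * b ^ L + r)"
    using frac_le[of 1 1 "real (m * b ^ L + r)" "real (m + 1) * real b ^ L"]
    by (simp add: mult.commute)
qed

lemma digit_prob_sums_renewal:
  fixes g s :: "nat \<Rightarrow> nat"
  assumes "b \<ge> 2"
  shows "(\<lambda>L. \<Sum>m\<in>M. digit_prob b L (int k - int (s m)) / real (g m))
    sums (\<Sum>m\<in>M. renewal b (int k - int (s m)) / real (g m))"
  unfolding renewal_def
  by (intro sums_sum sums_divide summable_sums summable_digit_prob assms)

text \<open>Splitting off a single leading digit (\<open>J = 0\<close>) already gives a convergent majorant.\<close>

lemma summable_block_sum: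
  assumes "b \<ge> 2"
  shows "summable (block_sum b k)"
proof (rule summable_comparison_test')
  show "summable (\<lambda>L. \<Sum>m = b ^ 0..<b ^ Suc 0. digit_prob b L (int k - int (digit_sum b m)) / real m)"
    by (rule sums_summable[OF digit_prob_sums_renewal[OF assms]])
  show "norm (block_sum b k L)
      \<le> (\<Sum>m = b ^ 0..<b ^ Suc 0. digit_prob b L (int k - int (digit_sum b m)) / real m)" for L
    using block_sum_le[OF assms, of k L 0] block_sum_nonneg[of b k L] by simp
qed

text \<open>
  Sorting by length turns the sum over a set into a series; positivity makes this legitimate and yields
  summability at the same time.
\<close>

lemma has_sum_digit_sum_class:
  assumes b: "b \<ge> 2"
  shows "((\<lambda>n. 1 / real n) has_sum (\<Sum>N. block_sum b k N)) {n. n \<ge> 1 \<and> digit_sum b n = k}"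
proof -
  define A where "A N = {n \<in> {b ^ N..<b ^ Suc N}. digit_sum b n = k}" for N
  have inner: "((\<lambda>n. 1 / real n) has_sum block_sum b k N) (A N)" for N
  proof -
    have "block_sum b k N = (\<Sum>n\<in>A N. 1 / real n)"
      unfolding block_sum_def A_def by (subst sum.inter_filter) (auto intro!: sum.cong)
    then show ?thesis by (simp add: has_sum_finite_iff A_def)
  qed
  have outer: "(block_sum b k has_sum (\<Sum>N. block_sum b k N)) UNIV"
    using block_sum_nonneg summable_sums[OF summable_block_sum[OF b]]
    by (intro sums_nonneg_imp_has_sum) auto
  have "(\<lambda>(N, n). 1 / real n) summable_on Sigma UNIV A"
    using inner outer by (intro summable_on_SigmaI[where g = "block_sum b k"]) (auto simp: summable_on_def)
  then have "((\<lambda>(N, n). 1 / real n) has_sum (\<Sum>N. block_sum b k N)) (Sigma UNIV A)"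
    using inner outer by (intro has_sum_SigmaI[where g = "block_sum b k"]) auto
  then have "((\<lambda>x. 1 / real (snd x)) has_sum (\<Sum>N. block_sum b k N)) (Sigma UNIV A)"
    by (simp add: case_prod_beta')
  moreover have "bij_betw snd (Sigma UNIV A) {n. n \<ge> 1 \<and> digit_sum b n = k}"
  proof (rule bij_betwI')
    fix x y assume "x \<in> Sigma UNIV A" "y \<in> Sigma UNIV A"
    then obtain N n N' n' where xy: "x = (N, n)" "y = (N', n')"
      "b ^ N \<le> n" "n < b ^ Suc N" "b ^ N' \<le> n'" "n' < b ^ Suc N'"
      by (auto simp: A_def)
    have "N = N'" if "n = n'"
    proof -
      have "b ^ N < b ^ Suc N'" "b ^ N' < b ^ Suc N" using xy that by linarith+
      then show ?thesis using b by (simp only: power_strict_increasing_iff)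
    qed
    then show "snd x = snd y \<longleftrightarrow> x = y" using xy by auto
  next
    fix x assume "x \<in> Sigma UNIV A"
    then obtain N n where "x = (N, n)" "b ^ N \<le> n" "digit_sum b n = k" by (auto simp: A_def)
    moreover have "1 \<le> b ^ N" using b by simp
    ultimately show "snd x \<in> {n. n \<ge> 1 \<and> digit_sum b n = k}" by auto
  next
    fix n assume n: "n \<in> {n. n \<ge> 1 \<and> digit_sum b n = k}"
    then obtain N where "b ^ N \<le> n" "n < b ^ (N + 1)"
      using ex_power_ivl1[OF b, of n] by auto
    then show "\<exists>x\<in>Sigma UNIV A. n = snd x"
      using n by (intro bexI[of _ "(N, n)"]) (auto simp: A_def)
  qed
  ultimately show ?thesis
    by (simp add: has_sum_reindex_bij_betw[of snd _ _ "\<lambda>n. 1 / real n"])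
qed

section \<open>The limit\<close>

text \<open>
  From \<open>1 / (m + 1) \<le> ln (m + 1) - ln m \<le> 1 / m\<close>, the two sums enclose \<open>ln b\<close>, and their difference
  telescopes to \<open>1 / b ^ J - 1 / b ^ (J + 1)\<close>.
\<close>

lemma ln_block_bounds:
  assumes b: "b \<ge> 2"
  shows "(\<Sum>m = b ^ J..<b ^ Suc J. 1 / real m) \<le> ln (real b) + 1 / real b ^ J"
    and "ln (real b) - 1 / real b ^ J \<le> (\<Sum>m = b ^ J..<b ^ Suc J. 1 / real (m + 1))"
proof -
  have le: "b ^ J \<le> b ^ Suc J" using b by simp
  have pos: "m > 0" if "m \<in> {b ^ J..<b ^ Suc J}" for m
    using that b by (auto intro: less_le_trans[of 0 "b ^ J"])
  have "(\<Sum>m = b ^ J..<b ^ Suc J. ln (real (Suc m)) - ln (real m)) = ln (real (b ^ Suc J)) - ln (real (b ^ J))"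
    by (rule sum_Suc_diff'[OF le])
  also have "\<dots> = ln (real b)" using b by (simp add: ln_mult)
  finally have ln: "(\<Sum>m = b ^ J..<b ^ Suc J. ln (real (Suc m)) - ln (real m)) = ln (real b)" .
  have "(\<Sum>m = b ^ J..<b ^ Suc J. (- 1 / real (Suc m)) - (- 1 / real m)) = - 1 / real (b ^ Suc J) - (- 1 / real (b ^ J))"
    by (rule sum_Suc_diff'[OF le])
  also have "\<dots> \<le> 1 / real b ^ J" using b by simp
  finally have gap: "(\<Sum>m = b ^ J..<b ^ Suc J. 1 / real m) - (\<Sum>m = b ^ J..<b ^ Suc J. 1 / real (m + 1)) \<le> 1 / real b ^ J"
    by (simp add: sum_subtractf sum_negf)
  have "(\<Sum>m = b ^ J..<b ^ Suc J. ln (real (Suc m)) - ln (real m)) \<le> (\<Sum>m = b ^ J..<b ^ Suc J. 1 / real m)"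
  proof (intro sum_mono)
    fix m assume "m \<in> {b ^ J..<b ^ Suc J}"
    then have "m > 0" by (rule pos)
    then show "ln (real (Suc m)) - ln (real m) \<le> 1 / real m"
      using ln_le_minus_one[of "real (Suc m) / real m"] by (simp add: ln_div field_simps)
  qed
  moreover have "(\<Sum>m = b ^ J..<b ^ Suc J. 1 / real (m + 1)) \<le> (\<Sum>m = b ^ J..<b ^ Suc J. ln (real (Suc m)) - ln (real m))"
  proof (intro sum_mono)
    fix m assume "m \<in> {b ^ J..<b ^ Suc J}"
    then have "m > 0" by (rule pos)
    then show "1 / real (m + 1) \<le> ln (real (Suc m)) - ln (real m)"
      using ln_le_minus_one[of "real m / real (m + 1)"] by (simp add: ln_div field_simps)
  qed
  ultimately show "(\<Sum>m = b ^ J..<b ^ Suc J. 1 / real m) \<le> ln (real b) + 1 / real b ^ J"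
    and "ln (real b) - 1 / real b ^ J \<le> (\<Sum>m = b ^ J..<b ^ Suc J. 1 / real (m + 1))"
    using ln gap by linarith+
qed

text \<open>
  Only finitely many integers have at most \<open>J\<close> digits, so a large digit sum rules them all out.
\<close>

lemma eventually_suminf_block_sum:
  assumes b: "b \<ge> 2"
  shows "\<forall>\<^sub>F k in sequentially. (\<Sum>N. block_sum b k N) = (\<Sum>L. block_sum b k (L + J))"
proof -
  have "\<forall>\<^sub>F k in sequentially. \<forall>n\<in>{..<b ^ J}. digit_sum b n < k"
    by (intro eventually_ball_finite ballI eventually_gt_at_top) auto
  then show ?thesis
  proof eventually_elim
    case (elim k)
    have "block_sum b k N = 0" if "N < J" for N
      unfolding block_sum_def
    proof (intro sum.neutral ballI)
      fix n assume n: "n \<in> {b ^ N..<b ^ Suc N}"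
      have "b ^ Suc N \<le> b ^ J" using b that by (intro power_increasing) auto
      then show "of_bool (digit_sum b n = k) / real n = 0" using elim n by fastforce
    qed
    then show ?case
      using suminf_split_initial_segment[OF summable_block_sum[OF b], of k J] by simp
  qed
qed

text \<open>
  For a given tolerance \<open>J\<close> is chosen first, by \<open>ln_block_bounds\<close>; only then does \<open>k\<close> tend to infinity
  in the finitely many renewal terms.
\<close>

lemma suminf_block_sum_tendsto:
  assumes b: "b \<ge> 2"
  shows "(\<lambda>k. \<Sum>N. block_sum b k N) \<longlonglongrightarrow> 2 * ln (real b) / (real b - 1)"
proof -
  define l where "l = 2 / (real b - 1)"
  have l: "l > 0" using b by (simp add: l_def)
  have summ: "summable (\<lambda>L. block_sum b k (L + J))" for k J
    using summable_block_sum[OF b] by (rule summable_ignore_initial_segment)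
  have renewal_sum: "(\<lambda>k. \<Sum>m\<in>M. renewal b (int k - int (digit_sum b m)) / real (g m))
      \<longlonglongrightarrow> l * (\<Sum>m\<in>M. 1 / real (g m))" for M and g :: "nat \<Rightarrow> nat"
  proof -
    have "(\<lambda>k. \<Sum>m\<in>M. renewal b (int k - int (digit_sum b m)) * (1 / real (g m)))
        \<longlonglongrightarrow> (\<Sum>m\<in>M. l * (1 / real (g m)))"
      unfolding l_def by (intro tendsto_sum tendsto_mult_right renewal_tendsto b)
    then show ?thesis by (simp add: sum_distrib_left)
  qed
  have inverse_power: "(\<lambda>J. 1 / real b ^ J) \<longlonglongrightarrow> 0"
    using LIMSEQ_inverse_realpow_zero[of "real b"] b by (simp add: inverse_eq_divide)
  have "(\<lambda>k. \<Sum>N. block_sum b k N) \<longlonglongrightarrow> l * ln (real b)"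
  proof (rule order_tendstoI)
    fix a assume a: "l * ln (real b) < a"
    have "(\<lambda>J. l * (ln (real b) + 1 / real b ^ J)) \<longlonglongrightarrow> l * (ln (real b) + 0)"
      by (intro tendsto_intros inverse_power)
    then have "\<forall>\<^sub>F J in sequentially. l * (ln (real b) + 1 / real b ^ J) < a"
      using a by (intro order_tendstoD(2)) auto
    then obtain J where "l * (ln (real b) + 1 / real b ^ J) < a"
      by (auto simp: eventually_sequentially)
    then have "l * (\<Sum>m = b ^ J..<b ^ Suc J. 1 / real m) < a"
      using mult_left_mono[OF ln_block_bounds(1)[OF b, of J], of l] l by linarith
    with renewal_sum have "\<forall>\<^sub>F k in sequentially.
        (\<Sum>m = b ^ J..<b ^ Suc J. renewal b (int k - int (digit_sum b m)) / real m) < a"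
      by (rule order_tendstoD(2))
    with eventually_suminf_block_sum[OF b, of J]
    show "\<forall>\<^sub>F k in sequentially. (\<Sum>N. block_sum b k N) < a"
    proof eventually_elim
      case (elim k)
      then show ?case
        using sums_le[OF block_sum_le[OF b] summable_sums[OF summ] digit_prob_sums_renewal[OF b], of k J]
        by simp
    qed
  next
    fix a assume a: "a < l * ln (real b)"
    have "(\<lambda>J. l * (ln (real b) - 1 / real b ^ J)) \<longlonglongrightarrow> l * (ln (real b) - 0)"
      by (intro tendsto_intros inverse_power)
    then have "\<forall>\<^sub>F J in sequentially. a < l * (ln (real b) - 1 / real b ^ J)"
      using a by (intro order_tendstoD(1)) auto
    then obtain J where "a < l * (ln (real b) - 1 / real b ^ J)"
      by (auto simp: eventually_sequentially)
    then have "a < l * (\<Sum>m = b ^ J..<b ^ Suc J. 1 / real (m + 1))"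
      using mult_left_mono[OF ln_block_bounds(2)[OF b, of J], of l] l by linarith
    with renewal_sum have "\<forall>\<^sub>F k in sequentially.
        a < (\<Sum>m = b ^ J..<b ^ Suc J. renewal b (int k - int (digit_sum b m)) / real (m + 1))"
      by (rule order_tendstoD(1))
    with eventually_suminf_block_sum[OF b, of J]
    show "\<forall>\<^sub>F k in sequentially. a < (\<Sum>N. block_sum b k N)"
    proof eventually_elim
      case (elim k)
      then show ?case
        using sums_le[OF block_sum_ge[OF b] digit_prob_sums_renewal[OF b] summable_sums[OF summ], of k J]
        by simp
    qed
  qed
  then show ?thesis by (simp add: l_def)
qed

theorem theorem2:
  fixes b :: nat
  assumes "b \<ge> 2"
  shows "(\<forall>k. (\<lambda>n. 1 / real n) summable_on {n. n \<ge> 1 \<and> digit_sum b n = k}) \<and>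
    (\<lambda>k. \<Sum>\<^sub>\<infinity>n | n \<ge> 1 \<and> digit_sum b n = k. 1 / real n)
      \<longlonglongrightarrow> 2 * ln (real b) / (real b - 1)"
  using has_sum_digit_sum_class[OF assms] suminf_block_sum_tendsto[OF assms]
  by (simp only: infsumI[OF has_sum_digit_sum_class[OF assms]]) (blast intro: has_sum_imp_summable)

end
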